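(* Let $(X,p,E)$ be a lattice-normed vector lattice, $(Y,m,F)$ a lattice-normed vector lattice with an order continuous Banach lattice $(F,\|\cdot\|_F)$, and $(Z,q,G)$ a lattice-normed vector lattice with a Banach lattice $(G,\|\cdot\|_G)$. If $T:X\to Y$ is a sequentially $up$-compact linear operator, $S:Y\to Z$ is a dominated lattice homomorphism, and $S(Y)$ is $up$-regular in $Z$, then $S\circ T$ is sequentially $up$-compact.
   Context: All vector lattices are real and Archimedean. A net $(x_\alpha)$ in a vector lattice $X$ order converges to $x$ (written $x_\alpha\xrightarrow{o}x$) if there is a net $(y_\beta)_{\beta\in B}$ (possibly with a different index set) with $y_\beta\downarrow 0$ such that for every $\beta$ there is $\alpha_\beta$ with $|x_\alpha-x|\le y_\beta$ for all $\alpha\ge\alpha_\beta$. A lattice-normed vector lattice (LNVL) is a triple $(X,p,E)$ with $X,E$ vector lattices and $p:X\to E_+$ such that $p(x)=0\Leftrightarrow x=0$, $p(\lambda x)=|\lambda|p(x)$, $p(x+y)\le p(x)+p(y)$, and $|x|\le|y|$ implies $p(x)\le p(y)$. A net $x_\alpha$ in $X$ unbounded $p$-converges to $x$ (written $x_\alpha\xrightarrow{up}x$) if $p(|x_\alpha-x|\wedge u)\xrightarrow{o}0$ in $E$ for all $u\in X_+$. A sequence $x_n$ is $p$-bounded if there is $e\in E$ with $p(x_n)\le e$ for all $n$. A linear operator $T:(X,p,E)\to(Y,m,F)$ is sequentially $up$-compact if for every $p$-bounded sequence $x_n$ in $X$ there are a subsequence $x_{n_k}$ and $y\in Y$ with $Tx_{n_k}\xrightarrow{up}y$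 in $Y$. A linear operator $S:(Y,m,F)\to(Z,q,G)$ is dominated if there is a positive operator $R:F\to G$ with $q(Sy)\le R(m(y))$ for all $y\in Y$. For an LNVL $(Z,q,G)$, a vector sublattice $W\subseteq Z$ (viewed as the LNVL $(W,q|_W,G)$) is $up$-regular in $Z$ if for every net $w_\alpha$ in $W$, $w_\alpha\xrightarrow{up}0$ in $W$ (testing only $u\in W_+$) implies $w_\alpha\xrightarrow{up}0$ in $Z$. *)

theory Defs
  imports "HOL-Analysis.Analysis" "HOL-Library.Lattice_Algebras"
begin

section \<open>Vector lattices and Banach lattices\<close>

text \<open>The modulus \<open>\<bar>x\<bar> = sup x (- x)\<close> comes from \<^class>\<open>lattice_ab_group_add_abs\<close>.\<close>

class archimedean_vector_lattice = ordered_real_vector + lattice_ab_group_add_abs +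
  assumes archimedean: "0 \<le> x \<Longrightarrow> (\<And>n::nat. real n *\<^sub>R x \<le> y) \<Longrightarrow> x = 0"

class banach_lattice = archimedean_vector_lattice + banach +
  assumes norm_mono_abs: "\<bar>x\<bar> \<le> \<bar>y\<bar> \<Longrightarrow> norm x \<le> norm y"

section \<open>Nets\<close>

text \<open>
  A net is given by an index set \<open>A\<close> with a reflexive transitive upward directed relation \<open>r\<close>
  on it and a function on the index type, of which only the values on \<open>A\<close> matter.
\<close>

definition directed_index :: "'i set \<Rightarrow> ('i \<Rightarrow> 'i \<Rightarrow> bool) \<Rightarrow> bool" where
  "directed_index A r \<longleftrightarrow>
     A \<noteq> {} \<and>
     (\<forall>a\<in>A. r a a) \<and>
     (\<forall>a\<in>A. \<forall>b\<in>A. \<forall>c\<in>A. r a b \<longrightarrow> r b c \<longrightarrow> r a c) \<and>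
     (\<forall>a\<in>A. \<forall>b\<in>A. \<exists>c\<in>A. r a c \<and> r b c)"

text \<open>\<open>y\<^sub>\<beta> \<down> 0\<close>: the net is decreasing and its infimum is \<open>0\<close>.\<close>

definition (in archimedean_vector_lattice) decreases_to_zero ::
    "'i set \<Rightarrow> ('i \<Rightarrow> 'i \<Rightarrow> bool) \<Rightarrow> ('i \<Rightarrow> 'a) \<Rightarrow> bool" where
  "decreases_to_zero B s y \<longleftrightarrow>
     (\<forall>\<beta>\<in>B. \<forall>\<gamma>\<in>B. s \<beta> \<gamma> \<longrightarrow> y \<gamma> \<le> y \<beta>) \<and>
     (\<forall>\<beta>\<in>B. 0 \<le> y \<beta>) \<and>
     (\<forall>z. (\<forall>\<beta>\<in>B. z \<le> y \<beta>) \<longrightarrow> z \<le> 0)"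

text \<open>
  Decreasing nets over an arbitrary index type can be reindexed by their range, so whenever one
  quantifies over all nets decreasing to zero it is enough to consider index sets of elements of
  the lattice itself.
\<close>

lemma decreases_to_zero_reindex:
  fixes y :: "'i \<Rightarrow> 'a::archimedean_vector_lattice"
  assumes "directed_index B s" and "decreases_to_zero B s y"
  shows "directed_index (y ` B) (\<lambda>a b. b \<le> a)"
    and "decreases_to_zero (y ` B) (\<lambda>a b. b \<le> a) (\<lambda>a. a)"
proof -
  show "directed_index (y ` B) (\<lambda>a b. b \<le> a)"
    unfolding directed_index_def
  proof (intro conjI ballI impI)
    fix a b assume "a \<in> y ` B" "b \<in> y ` B"
    then obtain \<beta> \<gamma> where *: "\<beta> \<in> B" "\<gamma> \<in> B" "a = y \<beta>" "b = y \<gamma>" by blast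
    then obtain \<delta> where "\<delta> \<in> B" "s \<beta> \<delta>" "s \<gamma> \<delta>"
      using assms(1) unfolding directed_index_def by blast
    then show "\<exists>c\<in>y ` B. c \<le> a \<and> c \<le> b"
      using assms(2) * unfolding decreases_to_zero_def by blast
  qed (use assms(1) in \<open>auto simp: directed_index_def\<close>)
  show "decreases_to_zero (y ` B) (\<lambda>a b. b \<le> a) (\<lambda>a. a)"
    using assms(2) unfolding decreases_to_zero_def by blast
qed

definition order_converges ::
    "'i set \<Rightarrow> ('i \<Rightarrow> 'i \<Rightarrow> bool) \<Rightarrow> ('i \<Rightarrow> 'a::archimedean_vector_lattice) \<Rightarrow> 'a \<Rightarrow> bool" where
  "order_converges A r x l \<longleftrightarrow>
     (\<exists>(B::'a set) s (y::'a \<Rightarrow> 'a). directed_index B s \<and> decreases_to_zero B s y \<and>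
        (\<forall>\<beta>\<in>B. \<exists>\<alpha>\<^sub>0\<in>A. \<forall>\<alpha>\<in>A. r \<alpha>\<^sub>0 \<alpha> \<longrightarrow> \<bar>x \<alpha> - l\<bar> \<le> y \<beta>))"

lemma order_converges_any_index:
  fixes y :: "'j \<Rightarrow> 'a::archimedean_vector_lattice"
  assumes "directed_index B s" and "decreases_to_zero B s y"
    and "\<And>\<beta>. \<beta> \<in> B \<Longrightarrow> \<exists>\<alpha>\<^sub>0\<in>A. \<forall>\<alpha>\<in>A. r \<alpha>\<^sub>0 \<alpha> \<longrightarrow> \<bar>x \<alpha> - l\<bar> \<le> y \<beta>"
  shows "order_converges A r x l"
  unfolding order_converges_def
  using decreases_to_zero_reindex[OF assms(1,2)] assms(3)
  by (intro exI[of _ "y ` B"] exI[of _ "\<lambda>a b. b \<le> a"] exI[of _ "\<lambda>a. a"]) auto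

class order_continuous_banach_lattice = banach_lattice +
  assumes order_continuous_norm:
    "directed_index (B::'a set) s \<Longrightarrow> decreases_to_zero B s (y::'a \<Rightarrow> 'a) \<Longrightarrow> 0 < \<epsilon> \<Longrightarrow>
       \<exists>\<beta>\<^sub>0\<in>B. \<forall>\<beta>\<in>B. s \<beta>\<^sub>0 \<beta> \<longrightarrow> norm (y \<beta>) < \<epsilon>"

lemma order_continuous_norm_any_index:
  fixes y :: "'j \<Rightarrow> 'a::order_continuous_banach_lattice"
  assumes "directed_index B s" and y: "decreases_to_zero B s y" and "0 < \<epsilon>"
  shows "\<exists>\<beta>\<^sub>0\<in>B. \<forall>\<beta>\<in>B. s \<beta>\<^sub>0 \<beta> \<longrightarrow> norm (y \<beta>) < \<epsilon>"
proof -
  obtain \<beta>\<^sub>0 where "\<beta>\<^sub>0 \<in> B" and *: "\<forall>\<beta>\<in>B. y \<beta> \<le> y \<beta>\<^sub>0 \<longrightarrow> norm (y \<beta>) < \<epsilon>"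
    using order_continuous_norm[OF decreases_to_zero_reindex[OF assms(1,2)] assms(3)] by auto
  then show ?thesis using y unfolding decreases_to_zero_def by blast
qed

section \<open>Lattice-normed vector lattices\<close>

definition lattice_norm ::
    "('x::archimedean_vector_lattice \<Rightarrow> 'e::archimedean_vector_lattice) \<Rightarrow> bool" where
  "lattice_norm p \<longleftrightarrow>
     (\<forall>x. 0 \<le> p x) \<and>
     (\<forall>x. p x = 0 \<longleftrightarrow> x = 0) \<and>
     (\<forall>c x. p (c *\<^sub>R x) = \<bar>c\<bar> *\<^sub>R p x) \<and>
     (\<forall>x y. p (x + y) \<le> p x + p y) \<and>
     (\<forall>x y. \<bar>x\<bar> \<le> \<bar>y\<bar> \<longrightarrow> p x \<le> p y)"

definition vector_sublattice :: "'z::archimedean_vector_lattice set \<Rightarrow> bool" where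
  "vector_sublattice W \<longleftrightarrow> subspace W \<and> (\<forall>x\<in>W. \<forall>y\<in>W. sup x y \<in> W \<and> inf x y \<in> W)"

text \<open>
  \<open>up_converges W p A r x l\<close> is unbounded \<open>p\<close>-convergence in the LNVL whose underlying vector
  lattice is \<open>W\<close> (\<^term>\<open>UNIV\<close> for the whole type) and whose lattice norm is \<open>p\<close> restricted to
  \<open>W\<close>; it is meant for nets and limits in \<open>W\<close>.
\<close>

definition up_converges ::
    "'x set \<Rightarrow> ('x::archimedean_vector_lattice \<Rightarrow> 'e::archimedean_vector_lattice) \<Rightarrow>
     'i set \<Rightarrow> ('i \<Rightarrow> 'i \<Rightarrow> bool) \<Rightarrow> ('i \<Rightarrow> 'x) \<Rightarrow> 'x \<Rightarrow> bool" where
  "up_converges W p A r x l \<longleftrightarrow>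
     (\<forall>u\<in>W. 0 \<le> u \<longrightarrow> order_converges A r (\<lambda>\<alpha>. p (inf \<bar>x \<alpha> - l\<bar> u)) 0)"

text \<open>
  The nets range over index sets of type \<^typ>\<open>('z \<times> 'z set) set\<close>; lemma \<open>up_regular_any_index\<close>
  shows that this covers nets over all index types.
\<close>

definition up_regular ::
    "('z::archimedean_vector_lattice \<Rightarrow> 'g::archimedean_vector_lattice) \<Rightarrow> 'z set \<Rightarrow> bool" where
  "up_regular q W \<longleftrightarrow>
     vector_sublattice W \<and>
     (\<forall>(A::('z \<times> 'z set) set) r w. directed_index A r \<longrightarrow> (\<forall>\<alpha>\<in>A. w \<alpha> \<in> W) \<longrightarrow>
        up_converges W q A r w 0 \<longrightarrow> up_converges UNIV q A r w 0)"

lemma up_regular_any_index: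
  fixes A :: "'i set" and w :: "'i \<Rightarrow> 'z::archimedean_vector_lattice"
  assumes reg: "up_regular q W" and dir: "directed_index A r" and w: "\<forall>\<alpha>\<in>A. w \<alpha> \<in> W"
    and conv: "up_converges W q A r w 0"
  shows "up_converges UNIV q A r w 0"
proof -
  define T where "T a = {w \<alpha> |\<alpha>. \<alpha> \<in> A \<and> r a \<alpha>}" for a
  define B where "B = {(z, T a) |z a. a \<in> A \<and> z \<in> T a}"
  define s where "s = (\<lambda>(b :: 'z \<times> 'z set) (c :: 'z \<times> 'z set). snd c \<subseteq> snd b)"
  have refl: "w a \<in> T a" if "a \<in> A" for a
    using dir that unfolding T_def directed_index_def by blast
  have mono: "T b \<subseteq> T a" if "a \<in> A" "b \<in> A" "r a b" for a b
    using dir that unfolding T_def directed_index_def by blast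
  have dirB: "directed_index B s"
    unfolding directed_index_def
  proof (intro conjI ballI impI)
    show "B \<noteq> {}" using dir refl unfolding B_def directed_index_def by blast
  next
    fix b c assume "b \<in> B" "c \<in> B"
    then obtain a a' where a: "a \<in> A" "a' \<in> A" "snd b = T a" "snd c = T a'"
      unfolding B_def by auto
    then obtain d where d: "d \<in> A" "r a d" "r a' d"
      using dir unfolding directed_index_def by blast
    then have "(w d, T d) \<in> B" using refl unfolding B_def by blast
    moreover have "s b (w d, T d)" "s c (w d, T d)"
      using a d mono unfolding s_def by auto
    ultimately show "\<exists>e\<in>B. s b e \<and> s c e" by blast
  qed (auto simp: s_def)
  have tails: "(\<exists>\<alpha>\<^sub>0\<in>A. \<forall>\<alpha>\<in>A. r \<alpha>\<^sub>0 \<alpha> \<longrightarrow> P (w \<alpha>)) \<longleftrightarrow> (\<exists>b\<in>B. \<forall>c\<in>B. s b c \<longrightarrow> P (fst c))"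
    for P
  proof
    assume "\<exists>\<alpha>\<^sub>0\<in>A. \<forall>\<alpha>\<in>A. r \<alpha>\<^sub>0 \<alpha> \<longrightarrow> P (w \<alpha>)"
    then obtain a where a: "a \<in> A" "\<forall>z\<in>T a. P z" unfolding T_def by blast
    then have "(w a, T a) \<in> B" using refl unfolding B_def by blast
    moreover have "P (fst c)" if "c \<in> B" "s (w a, T a) c" for c
      using that a unfolding B_def s_def by auto
    ultimately show "\<exists>b\<in>B. \<forall>c\<in>B. s b c \<longrightarrow> P (fst c)" by blast
  next
    assume "\<exists>b\<in>B. \<forall>c\<in>B. s b c \<longrightarrow> P (fst c)"
    then obtain z a where a: "a \<in> A" and *: "\<forall>c\<in>B. s (z, T a) c \<longrightarrow> P (fst c)"
      unfolding B_def by blast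
    have "P (w \<alpha>)" if "\<alpha> \<in> A" "r a \<alpha>" for \<alpha>
    proof -
      have "(w \<alpha>, T a) \<in> B" using that a unfolding B_def T_def by blast
      then show ?thesis using * unfolding s_def by fastforce
    qed
    then show "\<exists>\<alpha>\<^sub>0\<in>A. \<forall>\<alpha>\<in>A. r \<alpha>\<^sub>0 \<alpha> \<longrightarrow> P (w \<alpha>)" using a by blast
  qed
  have eq: "up_converges V q A r w 0 \<longleftrightarrow> up_converges V q B s fst 0" for V
    unfolding up_converges_def order_converges_def
    using tails[of "\<lambda>z. \<bar>q (inf \<bar>z - 0\<bar> u) - 0\<bar> \<le> d" for u d] by simp
  have "\<forall>b\<in>B. fst b \<in> W" using w unfolding B_def T_def by auto
  then show ?thesis using reg dirB conv unfolding up_regular_def eq by blast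
qed

section \<open>Operators\<close>

definition p_bounded ::
    "('x::archimedean_vector_lattice \<Rightarrow> 'e::archimedean_vector_lattice) \<Rightarrow> (nat \<Rightarrow> 'x) \<Rightarrow> bool" where
  "p_bounded p x \<longleftrightarrow> (\<exists>e. \<forall>n. p (x n) \<le> e)"

definition seq_up_compact ::
    "('x::archimedean_vector_lattice \<Rightarrow> 'e::archimedean_vector_lattice) \<Rightarrow>
     ('y::archimedean_vector_lattice \<Rightarrow> 'f::archimedean_vector_lattice) \<Rightarrow> ('x \<Rightarrow> 'y) \<Rightarrow> bool" where
  "seq_up_compact p m T \<longleftrightarrow>
     linear T \<and>
     (\<forall>x. p_bounded p x \<longrightarrow>
        (\<exists>k y. strict_mono (k::nat \<Rightarrow> nat) \<and>
           up_converges UNIV m UNIV (\<le>) (\<lambda>j. T (x (k j))) y))"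

definition positive_operator ::
    "('f::archimedean_vector_lattice \<Rightarrow> 'g::archimedean_vector_lattice) \<Rightarrow> bool" where
  "positive_operator R \<longleftrightarrow> linear R \<and> (\<forall>f. 0 \<le> f \<longrightarrow> 0 \<le> R f)"

definition dominated ::
    "('y::archimedean_vector_lattice \<Rightarrow> 'f::archimedean_vector_lattice) \<Rightarrow>
     ('z::archimedean_vector_lattice \<Rightarrow> 'g::archimedean_vector_lattice) \<Rightarrow> ('y \<Rightarrow> 'z) \<Rightarrow> bool" where
  "dominated m q S \<longleftrightarrow> linear S \<and> (\<exists>R. positive_operator R \<and> (\<forall>y. q (S y) \<le> R (m y)))"

definition lattice_homomorphism ::
    "('y::archimedean_vector_lattice \<Rightarrow> 'z::archimedean_vector_lattice) \<Rightarrow> bool" where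
  "lattice_homomorphism S \<longleftrightarrow>
     linear S \<and> (\<forall>x y. S (sup x y) = sup (S x) (S y)) \<and> (\<forall>x y. S (inf x y) = inf (S x) (S y))"

lemma vector_sublattice_range:
  assumes "lattice_homomorphism S"
  shows "vector_sublattice (range S)"
proof -
  have "subspace (range S)"
    using assms linear_subspace_image subspace_UNIV unfolding lattice_homomorphism_def by blast
  moreover have "sup (S x) (S y) \<in> range S" "inf (S x) (S y) \<in> range S" for x y
    using assms unfolding lattice_homomorphism_def by (metis rangeI)+
  ultimately show ?thesis unfolding vector_sublattice_def by blast
qed

end

theory Submission
  imports Defs
begin

text \<open>
  If \<open>y\<^sub>\<beta> \<down> 0\<close> in \<open>F\<close>, order continuity of the norm gives indices \<open>\<beta>\<^sub>n\<close> for which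
  \<open>v = \<Sum>n. n y\<^bsub>\<beta>\<^sub>n\<^esub>\<close> converges. A lower bound \<open>z\<close> of all \<open>R y\<^sub>\<beta>\<close> then satisfies \<open>n z \<le> R v\<close>
  for all \<open>n\<close>, so \<open>z \<le> 0\<close> because \<open>G\<close> is Archimedean. Thus a positive operator \<open>R\<close> preserves
  order null nets. Applied to the dominant of \<open>S\<close>, this transports the
  \<open>up\<close>-convergence of \<open>T x\<^bsub>n\<^sub>k\<^esub>\<close> to \<open>S T x\<^bsub>n\<^sub>k\<^esub>\<close> within \<open>S(Y)\<close>, along the same subsequence, and
  \<open>up\<close>-regularity extends it to \<open>Z\<close>.
\<close>

text \<open>The negative part \<open>sup (- l) 0\<close> lies below the modulus of
  \<open>f n - l\<close> whenever \<open>f n\<close> is nonnegative. Monotonicity of the norm then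
  forces it to vanish in the limit.\<close>

lemma banach_lattice_limit_nonneg:
  fixes f :: "nat \<Rightarrow> 'a::banach_lattice"
  assumes "f \<longlonglongrightarrow> l" and nonneg: "eventually (\<lambda>n. 0 \<le> f n) sequentially"
  shows "0 \<le> l"
proof -
  have bound: "norm (sup (- l) 0) \<le> norm (f n - l)" if "0 \<le> f n" for n
  proof (rule norm_mono_abs)
    have "- l \<le> f n - l" using that by simp
    also have "\<dots> \<le> \<bar>f n - l\<bar>" by (rule abs_ge_self)
    finally have "sup (- l) 0 \<le> \<bar>f n - l\<bar>" by simp
    then show "\<bar>sup (- l) 0\<bar> \<le> \<bar>f n - l\<bar>" by simp
  qed
  have "(\<lambda>n. norm (f n - l)) \<longlonglongrightarrow> 0"
    using assms(1) by (simp add: LIM_zero tendsto_norm_zero)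
  then have "norm (sup (- l) 0) \<le> 0"
    using nonneg bound by (intro tendsto_lowerbound) (auto elim: eventually_mono)
  then have "- l \<le> 0" by (metis norm_le_zero_iff sup.cobounded1)
  then show ?thesis by simp
qed

text \<open>Every partial sum that includes the index \<open>n\<close> exceeds \<open>f n\<close> by
  a sum of nonnegative terms, and the positive cone is closed.\<close>

lemma banach_lattice_le_suminf:
  fixes f :: "nat \<Rightarrow> 'a::banach_lattice"
  assumes "summable f" and nonneg: "\<And>n. 0 \<le> f n"
  shows "f n \<le> suminf f"
proof -
  have "(\<lambda>N. sum f {..<N} - f n) \<longlonglongrightarrow> suminf f - f n"
    using summable_LIMSEQ[OF assms(1)] by (intro tendsto_diff tendsto_const)
  moreover have "eventually (\<lambda>N. 0 \<le> sum f {..<N} - f n) sequentially"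
    using eventually_gt_at_top[of n]
  proof eventually_elim
    case (elim N)
    then show ?case using nonneg by (simp add: sum.remove[of "{..<N}" n f] sum_nonneg)
  qed
  ultimately have "0 \<le> suminf f - f n" by (rule banach_lattice_limit_nonneg)
  then show ?thesis by simp
qed

lemma positive_operator_mono:
  assumes "positive_operator R" and "a \<le> b"
  shows "R a \<le> R b"
proof -
  have "0 \<le> R (b - a)" using assms unfolding positive_operator_def by simp
  then show ?thesis using assms(1) unfolding positive_operator_def by (simp add: linear_diff)
qed

lemma positive_operator_decreases_to_zero:
  fixes R :: "'f::order_continuous_banach_lattice \<Rightarrow> 'g::archimedean_vector_lattice"
  assumes R: "positive_operator R" and dir: "directed_index B s"
    and dec: "decreases_to_zero B s y"
  shows "decreases_to_zero B s (\<lambda>\<beta>. R (y \<beta>))"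
proof -
  have y_nonneg: "0 \<le> y \<beta>" if "\<beta> \<in> B" for \<beta>
    using dec that unfolding decreases_to_zero_def by blast
  have "z \<le> 0" if z: "\<forall>\<beta>\<in>B. z \<le> R (y \<beta>)" for z
  proof -
    \<comment> \<open>The divisor \<open>real (Suc n)\<close> offsets the weight in \<open>f\<close>
      below, so that the weighted terms are still bounded in norm by a geometric series.\<close>
    have "\<exists>\<beta>. \<beta> \<in> B \<and> norm (y \<beta>) < (1/2) ^ n / real (Suc n)" for n
    proof -
      have "0 < (1/2) ^ n / real (Suc n)" by simp
      then obtain \<beta> where "\<beta> \<in> B" "\<forall>\<gamma>\<in>B. s \<beta> \<gamma> \<longrightarrow> norm (y \<gamma>) < (1/2) ^ n / real (Suc n)"
        using order_continuous_norm_any_index[OF dir dec] by blast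
      moreover have "s \<beta> \<beta>" using \<open>\<beta> \<in> B\<close> dir unfolding directed_index_def by blast
      ultimately show ?thesis by blast
    qed
    then obtain b where b: "\<And>n. b n \<in> B"
      and small: "\<And>n. norm (y (b n)) < (1/2) ^ n / real (Suc n)" by metis
    define f where "f n = real (Suc n) *\<^sub>R y (b n)" for n
    have f_nonneg: "0 \<le> f n" for n
      unfolding f_def using y_nonneg[OF b] by (intro scaleR_nonneg_nonneg) auto
    have "norm (f n) \<le> (1/2) ^ n" for n
    proof -
      have "norm (f n) = norm (y (b n)) * real (Suc n)" unfolding f_def by simp
      also have "\<dots> < (1/2) ^ n"
        using small[of n] by (subst (asm) pos_less_divide_eq) simp_all
      finally show ?thesis by simp
    qed
    then have sm: "summable f"
      using summable_comparison_test'[of "\<lambda>n. (1/2) ^ n :: real" 0 f] by (simp add: summable_geometric)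
    define v where "v = R (suminf f)"
    have upper: "real (Suc n) *\<^sub>R R (y (b n)) \<le> v" for n
      using positive_operator_mono[OF R banach_lattice_le_suminf[OF sm f_nonneg, of n]] R
      unfolding v_def f_def positive_operator_def by (simp only: linear_scale)
    have Ry: "0 \<le> R (y (b n))" for n
      using R y_nonneg[OF b] unfolding positive_operator_def by blast
    \<comment> \<open>The Archimedean axiom needs a nonnegative element, so \<open>z\<close> is
      replaced by its positive part, which is also below every \<open>R (y (b n))\<close>.\<close>
    have "real (Suc n) *\<^sub>R sup z 0 \<le> v" for n
    proof -
      have "sup z 0 \<le> R (y (b n))" using z b Ry by simp
      then have "real (Suc n) *\<^sub>R sup z 0 \<le> real (Suc n) *\<^sub>R R (y (b n))"
        by (intro scaleR_left_mono) auto
      then show ?thesis using upper order_trans by blast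
    qed
    \<comment> \<open>This covers the multiple 0, since the bounds so far start at
      \<open>Suc 0\<close>.\<close>
    moreover have "0 \<le> v"
      using upper[of 0] Ry[of 0] by simp
    ultimately have "real n *\<^sub>R sup z 0 \<le> v" for n
      by (cases n) auto
    then have "sup z 0 = 0" by (intro archimedean[of "sup z 0" v]) auto
    then show ?thesis by (metis sup.cobounded1)
  qed
  moreover have "R (y \<gamma>) \<le> R (y \<beta>)" if "\<beta> \<in> B" "\<gamma> \<in> B" "s \<beta> \<gamma>" for \<beta> \<gamma>
    using dec that positive_operator_mono[OF R] unfolding decreases_to_zero_def by blast
  moreover have "0 \<le> R (y \<beta>)" if "\<beta> \<in> B" for \<beta>
    using R y_nonneg[OF that] unfolding positive_operator_def by blast
  ultimately show ?thesis unfolding decreases_to_zero_def by simp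
qed

lemma order_converges_dominated:
  fixes R :: "'f::order_continuous_banach_lattice \<Rightarrow> 'g::archimedean_vector_lattice"
  assumes R: "positive_operator R" and conv: "order_converges A r x 0"
    and le: "\<And>\<alpha>. \<bar>w \<alpha>\<bar> \<le> R (x \<alpha>)"
  shows "order_converges A r w 0"
proof -
  obtain B :: "'f set" and s y where dir: "directed_index B s" and dec: "decreases_to_zero B s y"
    and tail: "\<forall>\<beta>\<in>B. \<exists>\<alpha>\<^sub>0\<in>A. \<forall>\<alpha>\<in>A. r \<alpha>\<^sub>0 \<alpha> \<longrightarrow> \<bar>x \<alpha> - 0\<bar> \<le> y \<beta>"
    using conv unfolding order_converges_def by blast
  have "\<bar>w \<alpha> - 0\<bar> \<le> R (y \<beta>)" if "\<bar>x \<alpha> - 0\<bar> \<le> y \<beta>" for \<alpha> \<beta>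
  proof -
    have "x \<alpha> \<le> y \<beta>" using that abs_ge_self[of "x \<alpha>"] by simp
    then show ?thesis using le[of \<alpha>] positive_operator_mono[OF R] order_trans by fastforce
  qed
  \<comment> \<open>The dominating net \<open>R (y \<beta>)\<close> takes values in
    \<open>'g\<close> but is indexed by a subset of \<open>'f\<close>, hence the reindexing
    lemma.\<close>
  then show ?thesis
    using tail
    by (intro order_converges_any_index[OF dir positive_operator_decreases_to_zero[OF R dir dec]])
      blast
qed

lemma lattice_homomorphism_abs:
  assumes "lattice_homomorphism S"
  shows "S \<bar>x\<bar> = \<bar>S x\<bar>"
  using assms unfolding lattice_homomorphism_def by (simp add: abs_lattice linear_neg)

text \<open>Nonnegative test elements of the range lift to nonnegative ones in the domain, and
  \<open>S\<close> commutes with modulus and infimum. The dominant of \<open>S\<close> then carries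
  each tested net from \<open>m\<close> to \<open>q\<close>.\<close>

lemma up_converges_range:
  fixes m :: "'y::archimedean_vector_lattice \<Rightarrow> 'f::order_continuous_banach_lattice"
  assumes q: "lattice_norm q" and dom: "dominated m q S" and hom: "lattice_homomorphism S"
    and conv: "up_converges UNIV m A r x l"
  shows "up_converges (range S) q A r (\<lambda>\<alpha>. S (x \<alpha>) - S l) 0"
  unfolding up_converges_def
proof (intro ballI impI)
  fix w assume "w \<in> range S" and "0 \<le> w"
  then obtain u where "w = S u" by blast
  \<comment> \<open>The preimage \<open>u\<close> itself need not be positive, but its modulus has
    the same image because \<open>w\<close> equals its own modulus.\<close>
  then have u: "w = S \<bar>u\<bar>"
    using \<open>0 \<le> w\<close> lattice_homomorphism_abs[OF hom, of u] by simp
  obtain R where R: "positive_operator R" and le: "\<And>y. q (S y) \<le> R (m y)"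
    using dom unfolding dominated_def by blast
  have eq: "inf \<bar>S (x \<alpha>) - S l - 0\<bar> w = S (inf \<bar>x \<alpha> - l\<bar> \<bar>u\<bar>)" for \<alpha>
    using hom lattice_homomorphism_abs[OF hom, of "x \<alpha> - l"]
    unfolding u lattice_homomorphism_def by (simp add: linear_diff)
  have "order_converges A r (\<lambda>\<alpha>. m (inf \<bar>x \<alpha> - l\<bar> \<bar>u\<bar>)) 0"
    using conv unfolding up_converges_def by simp
  then show "order_converges A r (\<lambda>\<alpha>. q (inf \<bar>S (x \<alpha>) - S l - 0\<bar> w)) 0"
    unfolding eq
    by (rule order_converges_dominated[OF R]) (use q le in \<open>simp add: lattice_norm_def\<close>)
qed

theorem corollary4:
  fixes p :: "'x::archimedean_vector_lattice \<Rightarrow> 'e::archimedean_vector_lattice"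
    and m :: "'y::archimedean_vector_lattice \<Rightarrow> 'f::order_continuous_banach_lattice"
    and q :: "'z::archimedean_vector_lattice \<Rightarrow> 'g::banach_lattice"
    and T :: "'x \<Rightarrow> 'y" and S :: "'y \<Rightarrow> 'z"
  assumes "lattice_norm p" and "lattice_norm m" and "lattice_norm q"
    and "seq_up_compact p m T"
    and "dominated m q S" and "lattice_homomorphism S"
    and "up_regular q (range S)"
  shows "seq_up_compact p q (S \<circ> T)"
  unfolding seq_up_compact_def
proof (intro conjI allI impI)
  have S: "linear S" using assms(6) unfolding lattice_homomorphism_def by blast
  show "linear (S \<circ> T)"
    using assms(4) S linear_compose unfolding seq_up_compact_def by blast
  fix x assume "p_bounded p x"
  then obtain k y where k: "strict_mono (k::nat \<Rightarrow> nat)"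
    and "up_converges UNIV m UNIV (\<le>) (\<lambda>j. T (x (k j))) y"
    using assms(4) unfolding seq_up_compact_def by blast
  \<comment> \<open>The limit is subtracted first because up-regularity speaks only of nets
    converging to 0.\<close>
  then have conv: "up_converges (range S) q UNIV (\<le>) (\<lambda>j. S (T (x (k j))) - S y) 0"
    using up_converges_range[OF assms(3,5,6)] by blast
  have "directed_index (UNIV::nat set) (\<le>)"
    unfolding directed_index_def by (auto intro: max.cobounded1 max.cobounded2)
  moreover have "\<forall>j\<in>UNIV. S (T (x (k j))) - S y \<in> range S"
    using S by (metis linear_diff rangeI)
  ultimately have "up_converges UNIV q UNIV (\<le>) (\<lambda>j. S (T (x (k j))) - S y) 0"
    using conv by (rule up_regular_any_index[OF assms(7)])
  then have "up_converges UNIV q UNIV (\<le>) (\<lambda>j. (S \<circ> T) (x (k j))) (S y)"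
    unfolding up_converges_def by simp
  then show "\<exists>k y. strict_mono (k::nat \<Rightarrow> nat) \<and>
      up_converges UNIV q UNIV (\<le>) (\<lambda>j. (S \<circ> T) (x (k j))) y"
    using k by blast
qed

end
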